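(* Let $G$ be a computable ordered group and let $\alpha$ be an ordinal. If $G$ has order type $\mathbb{Z}^{\alpha}$, then $\alpha<\omega_1^{\mathrm{CK}}$.
   Context: An ordered group is a group $G$ with a linear order $\leq$ such that $a\leq b$ implies $ag\leq bg$ and $ga\leq gb$ for all $g\in G$. It is computable if it is presented on a computable subset of $\mathbb{N}$ with computable group operation and computable order relation. A linear order $X$ is the order type of $G$ if there is an order-preserving bijection $G\to X$. For a linear order $X$, $\mathbb{Z}^X$ is the set of finitely supported functions $X\to\mathbb{Z}$, where for $f\neq g$, $f<g$ iff $f(x)<g(x)$ at the maximum $x$ where $f,g$ differ. $\omega_1^{\mathrm{CK}}$ is the least non-computable ordinal. *)

theory Defs
  imports "HOL-Algebra.Group" "HOL-Library.Countable"
begin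

unbundle cardinal_syntax

section \<open>Computability\<close>

datatype recf =
    Zero
  | Succ
  | Proj nat
  | Comp recf "recf list"
  | PrimRec recf recf
  | Mu recf

text \<open>
  The graph of the partial function denoted by a term: \<open>eval p xs z\<close> means that \<open>p\<close> halts on the
  argument tuple \<open>xs\<close> with value \<open>z\<close>.  The functions denoted are exactly the partial recursive ones.
\<close>

inductive eval :: "recf \<Rightarrow> nat list \<Rightarrow> nat \<Rightarrow> bool" where
  Zero: "eval Zero xs 0"
| Succ: "eval Succ [x] (Suc x)"
| Proj: "i < length xs \<Longrightarrow> eval (Proj i) xs (xs ! i)"
| Comp: "list_all2 (\<lambda>g y. eval g xs y) gs ys \<Longrightarrow> eval f ys z \<Longrightarrow> eval (Comp f gs) xs z"
| PrimRec_0: "eval f xs z \<Longrightarrow> eval (PrimRec f g) (0 # xs) z"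
| PrimRec_Suc: "eval (PrimRec f g) (n # xs) y \<Longrightarrow> eval g (n # y # xs) z \<Longrightarrow>
    eval (PrimRec f g) (Suc n # xs) z"
| Mu: "eval f (n # xs) 0 \<Longrightarrow> (\<forall>m<n. \<exists>y. eval f (m # xs) (Suc y)) \<Longrightarrow> eval (Mu f) xs n"

lemma eval_deterministic: "eval p xs y \<Longrightarrow> eval p xs z \<Longrightarrow> y = z"
proof (induction arbitrary: z rule: eval.induct)
  case (Comp xs gs ys f z z')
  from Comp.prems obtain ys' where ys': "list_all2 (\<lambda>g y. eval g xs y) gs ys'" "eval f ys' z'"
    by (cases rule: eval.cases)
  have "ys = ys'"
  proof (rule nth_equalityI)
    show "length ys = length ys'"
      using list_all2_lengthD[OF Comp.IH(1)] list_all2_lengthD[OF ys'(1)] by simp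
    show "ys ! i = ys' ! i" if "i < length ys" for i
      using that list_all2_nthD2[OF Comp.IH(1)] list_all2_nthD[OF ys'(1)]
        list_all2_lengthD[OF Comp.IH(1)] by simp
  qed
  with Comp.IH(2) ys'(2) show ?case by blast
next
  case (PrimRec_0 f xs z g z')
  from PrimRec_0.prems have "eval f xs z'"
    by (cases rule: eval.cases)
  with PrimRec_0.IH show ?case by blast
next
  case (PrimRec_Suc f g n xs y z z')
  from PrimRec_Suc.prems obtain y' where "eval (PrimRec f g) (n # xs) y'" "eval g (n # y' # xs) z'"
    by (cases rule: eval.cases)
  with PrimRec_Suc.IH show ?case by blast
next
  case (Mu f n xs z)
  from Mu.prems have z: "eval f (z # xs) 0" "\<forall>m<z. \<exists>y. eval f (m # xs) (Suc y)"
    by (cases rule: eval.cases; blast)+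
  show ?case
  proof (cases n z rule: linorder_cases)
    case less
    with z(2) Mu.IH(1) show ?thesis by blast
  next
    case greater
    with z(1) Mu.IH(2) show ?thesis by blast
  qed
qed (erule eval.cases; simp)+

definition computable_set :: "nat set \<Rightarrow> bool" where
  "computable_set A \<longleftrightarrow> (\<exists>p. \<forall>x. eval p [x] (if x \<in> A then 1 else 0))"

definition computable_rel :: "nat rel \<Rightarrow> bool" where
  "computable_rel r \<longleftrightarrow> (\<exists>p. \<forall>x y. eval p [x, y] (if (x, y) \<in> r then 1 else 0))"

definition computable_op_on :: "nat set \<Rightarrow> (nat \<Rightarrow> nat \<Rightarrow> nat) \<Rightarrow> bool" where
  "computable_op_on A f \<longleftrightarrow> (\<exists>p. \<forall>x\<in>A. \<forall>y\<in>A. eval p [x, y] (f x y))"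


section \<open>Ordered groups\<close>

locale ordered_group = group G for G (structure) +
  fixes R :: "'a rel"
  assumes linear_order: "linear_order_on (carrier G) R"
    and mult_right_mono: "\<lbrakk>(a, b) \<in> R; g \<in> carrier G\<rbrakk> \<Longrightarrow> (a \<otimes> g, b \<otimes> g) \<in> R"
    and mult_left_mono: "\<lbrakk>(a, b) \<in> R; g \<in> carrier G\<rbrakk> \<Longrightarrow> (g \<otimes> a, g \<otimes> b) \<in> R"

definition computable_ordered_group :: "nat monoid \<Rightarrow> nat rel \<Rightarrow> bool" where
  "computable_ordered_group G R \<longleftrightarrow>
     ordered_group G R \<and> computable_set (carrier G) \<and>
     computable_op_on (carrier G) (mult G) \<and> computable_rel R"


section \<open>Order types\<close>

definition has_order_type :: "'a rel \<Rightarrow> 'b rel \<Rightarrow> bool" where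
  "has_order_type r s \<longleftrightarrow>
     (\<exists>h. bij_betw h (Field r) (Field s) \<and>
          (\<forall>x\<in>Field r. \<forall>y\<in>Field r. (x, y) \<in> r \<longleftrightarrow> (h x, h y) \<in> s))"

text \<open>
  For a linear order \<open>r\<close> with underlying set \<open>X = Field r\<close>, a function \<open>X \<rightarrow> \<int>\<close> is represented by its
  extension by zero to the whole type.
\<close>

definition fin_supp_functions :: "'a set \<Rightarrow> ('a \<Rightarrow> int) set" where
  "fin_supp_functions X = {f. finite {x. f x \<noteq> 0} \<and> {x. f x \<noteq> 0} \<subseteq> X}"

definition int_power :: "'a rel \<Rightarrow> ('a \<Rightarrow> int) rel" where
  "int_power r = {(f, g). f \<in> fin_supp_functions (Field r) \<and> g \<in> fin_supp_functions (Field r) \<and>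
     (f = g \<or> (\<exists>x. f x \<noteq> g x \<and> (\<forall>y. f y \<noteq> g y \<longrightarrow> (y, x) \<in> r) \<and> f x < g x))}"


section \<open>The least non-computable ordinal\<close>

text \<open>Ordinals are represented by well-orders, compared by \<open>=o\<close>, \<open>\<le>o\<close> and \<open><o\<close>.\<close>

definition computable_ordinal :: "'a rel \<Rightarrow> bool" where
  "computable_ordinal r \<longleftrightarrow>
     (\<exists>s :: nat rel. Well_order s \<and> computable_set (Field s) \<and> computable_rel s \<and> r =o s)"

text \<open>
  Non-computable well-orders already exist on sets of natural numbers, so the minimum may be taken
  over those; \<open>omega1_CK_least\<close> below shows that it is then minimal over all types.
\<close>

definition omega1_CK :: "nat rel" where
  "omega1_CK = (SOME r. Well_order r \<and> \<not> computable_ordinal r \<and>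
     (\<forall>s :: nat rel. Well_order s \<and> \<not> computable_ordinal s \<longrightarrow> r \<le>o s))"

instance recf :: countable
  by countable_datatype

lemma computable_ordinal_ordIso:
  assumes "r =o s" and "computable_ordinal s"
  shows "computable_ordinal r"
  using assms unfolding computable_ordinal_def by (blast intro: ordIso_transitive)

lemma ex_noncomputable_ordinal: "\<exists>r :: nat rel. Well_order r \<and> \<not> computable_ordinal r"
proof (rule ccontr)
  assume "\<not> ?thesis"
  then have all: "computable_ordinal r" if "Well_order r" for r :: "nat rel"
    using that by blast
  define U where "U = cardSuc natLeq"
  have card: "Card_order U" and wo: "Well_order U"
    unfolding U_def by (simp_all add: natLeq_Card_order cardSuc_Card_order cardSuc_Well_order)
  define seg where "seg x = Restr U (underS U x)" for x
  have ofil: "wo_rel.ofilter U (underS U x)" for x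
    using wo by (simp add: wo_rel.underS_ofilter wo_rel_def)
  have seg_wo: "Well_order (seg x)" for x
    unfolding seg_def using wo by (rule Well_order_Restr)
  have "\<exists>s. Well_order s \<and> computable_set (Field s) \<and> computable_rel s \<and> seg x =o s"
    if x: "x \<in> Field U" for x
  proof -
    have "|underS U x| <o U"
      using card x by (rule card_of_underS)
    then have "|underS U x| \<le>o natLeq"
      unfolding U_def by (simp add: cardSuc_ordLess_ordLeq natLeq_Card_order card_of_Card_order
          cardSuc_ordLeq_ordLess)
    then have "|underS U x| \<le>o |UNIV :: nat set|"
      using card_of_nat ordIso_symmetric ordLeq_ordIso_trans by blast
    then obtain h :: "_ \<Rightarrow> nat" where h: "inj_on h (underS U x)"
      by (auto simp: card_of_ordLeq[symmetric])
    have "inj_on h (Field (seg x))"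
      unfolding seg_def by (rule inj_on_subset[OF h Field_Restr_subset])
    with seg_wo have "seg x =o dir_image (seg x) h" and "Well_order (dir_image (seg x) h)"
      by (auto intro: dir_image_ordIso Well_order_dir_image)
    then have "computable_ordinal (seg x)"
      using all computable_ordinal_ordIso by blast
    then show ?thesis unfolding computable_ordinal_def .
  qed
  then obtain S where S: "\<And>x. x \<in> Field U \<Longrightarrow> computable_rel (S x) \<and> seg x =o S x"
    by metis
  then obtain P where P: "\<And>x a b. x \<in> Field U \<Longrightarrow> eval (P x) [a, b] (if (a, b) \<in> S x then 1 else 0)"
    unfolding computable_rel_def by metis
  have "inj_on P (Field U)"
  proof (rule inj_onI)
    fix x y assume x: "x \<in> Field U" and y: "y \<in> Field U" and eq: "P x = P y"
    have "(a, b) \<in> S x \<longleftrightarrow> (a, b) \<in> S y" for a b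
      using eval_deterministic[OF P[OF x, of a b] P[OF y, of a b, folded eq]]
      by (auto split: if_splits)
    then have "S x = S y" by auto
    then have iso: "seg x =o seg y"
      using S[OF x] S[OF y] by (metis ordIso_symmetric ordIso_transitive)
    then have "\<not> underS U x \<subset> underS U y" "\<not> underS U y \<subset> underS U x"
      using ofilter_subset_ordLess[OF wo ofil ofil] not_ordLess_ordIso ordIso_symmetric
      unfolding seg_def by blast+
    moreover have "underS U x \<subset> underS U y" if "(x, y) \<in> U" "x \<noteq> y" for x y
    proof -
      have "underS U x \<subseteq> underS U y"
        using wo that unfolding order_on_defs underS_def by (blast dest: transD antisymD)
      then show ?thesis using that unfolding underS_def by blast
    qed
    moreover have "x = y \<or> (x, y) \<in> U \<or> (y, x) \<in> U"
      using x y wo unfolding order_on_defs total_on_def by blast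
    ultimately show "x = y" by blast
  qed
  then have "inj_on (to_nat \<circ> P) (Field U)"
    by (simp add: comp_inj_on)
  then have "|Field U| \<le>o |UNIV :: nat set|"
    by (metis card_of_ordLeq subset_UNIV)
  then have "U \<le>o natLeq"
    using card card_of_Field_ordIso card_of_nat ordIso_symmetric
    by (meson ordIso_ordLeq_trans ordLeq_ordIso_trans)
  moreover have "natLeq <o U"
    unfolding U_def by (rule cardSuc_greater[OF natLeq_Card_order])
  ultimately show False
    using not_ordLess_ordLeq by blast
qed

lemma omega1_CK_props:
  "Well_order omega1_CK \<and> \<not> computable_ordinal omega1_CK \<and>
     (\<forall>s :: nat rel. Well_order s \<and> \<not> computable_ordinal s \<longrightarrow> omega1_CK \<le>o s)"
proof -
  let ?R = "{r :: nat rel. Well_order r \<and> \<not> computable_ordinal r}"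
  have "\<exists>r\<in>?R. \<forall>s\<in>?R. r \<le>o s"
    by (rule exists_minim_Well_order) (use ex_noncomputable_ordinal in auto)
  then obtain r where "r \<in> ?R" "\<forall>s\<in>?R. r \<le>o s" ..
  then have "Well_order r \<and> \<not> computable_ordinal r \<and>
      (\<forall>s :: nat rel. Well_order s \<and> \<not> computable_ordinal s \<longrightarrow> r \<le>o s)"
    by simp
  then show ?thesis
    unfolding omega1_CK_def by (rule someI)
qed

lemma omega1_CK_least:
  fixes s :: "'a rel"
  assumes s: "Well_order s" and nc: "\<not> computable_ordinal s"
  shows "omega1_CK \<le>o s"
proof (rule ccontr)
  assume "\<not> omega1_CK \<le>o s"
  then have lt: "s <o omega1_CK"
    using s omega1_CK_props not_ordLeq_iff_ordLess by blast
  then obtain p :: "nat rel" where p: "s =o p" "p <o omega1_CK"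
    using internalize_ordLess[of s omega1_CK] by blast
  then have "\<not> computable_ordinal p"
    using nc computable_ordinal_ordIso by blast
  moreover have "Well_order p"
    using p(2) unfolding ordLess_def by simp
  ultimately have "omega1_CK \<le>o p"
    using omega1_CK_props by simp
  with p(2) show False
    using not_ordLess_ordLeq by blast
qed

end

theory Submission
  imports Defs "HOL-Library.Nat_Bijection" "HOL-Library.Infinite_Set"
begin

text \<open>
  An order automorphism of \<open>\<int>\<^sup>\<alpha>\<close> preserves the largest index at which two functions differ, and left
  translations are order automorphisms.  Hence for positive \<open>a\<close>, \<open>b\<close> all powers of \<open>a\<close> lie below \<open>b\<close>
  iff the largest index at which \<open>a\<close> differs from \<open>1\<close> is smaller than the one for \<open>b\<close>: the
  Archimedean classes of \<open>G\<close> form a copy of \<open>\<alpha>\<close>.  Comparing classes is only co-c.e., but the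
  finite attempts at an infinite descending sequence of classes form a computable tree, well-founded because \<open>\<alpha>\<close> is.  Its Kleene--Brouwer order
  is a computable well-order of type at least \<open>\<alpha>\<close>, so \<open>\<alpha>\<close> is computable.  Since every class contains
  arbitrarily large natural numbers, increasing sequences suffice; these are finite sets, coded by
  binary expansions.
\<close>

section \<open>Computable functions on tuples\<close>

definition computable_fun :: "nat \<Rightarrow> (nat list \<Rightarrow> nat) \<Rightarrow> bool" where
  "computable_fun k f \<longleftrightarrow> (\<exists>p. \<forall>xs. length xs = k \<longrightarrow> eval p xs (f xs))"

definition computable_pred :: "nat \<Rightarrow> (nat list \<Rightarrow> bool) \<Rightarrow> bool" where
  "computable_pred k P \<longleftrightarrow> computable_fun k (\<lambda>xs. of_bool (P xs))"

lemma computable_fun_cong: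
  assumes "computable_fun k f" "\<And>xs. length xs = k \<Longrightarrow> f xs = g xs"
  shows "computable_fun k g"
  using assms unfolding computable_fun_def by metis

lemma computable_fun_nth: "i < k \<Longrightarrow> computable_fun k (\<lambda>xs. xs ! i)"
  unfolding computable_fun_def by (metis eval.Proj)

text \<open>Recursion and bounded quantification put their own variables at the front of the tuple,
  so older variables appear under \<open>tl\<close>. This lemma and the next make them accessible in
  that form.\<close>

lemma computable_fun_nth_tl:
  assumes "Suc i < k"
  shows "computable_fun k (\<lambda>xs. tl xs ! i)"
  by (rule computable_fun_cong[OF computable_fun_nth[OF assms]]) (use assms in \<open>auto simp: nth_tl\<close>)

lemma computable_fun_nth_tl2:
  assumes "Suc (Suc i) < k"
  shows "computable_fun k (\<lambda>xs. tl (tl xs) ! i)"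
  by (rule computable_fun_cong[OF computable_fun_nth[OF assms]]) (use assms in \<open>auto simp: nth_tl\<close>)

lemma computable_fun_Comp:
  assumes "computable_fun (length gs) f" "\<And>g. g \<in> set gs \<Longrightarrow> computable_fun k g"
  shows "computable_fun k (\<lambda>xs. f (map (\<lambda>g. g xs) gs))"
proof -
  obtain p where p: "\<And>xs. length xs = length gs \<Longrightarrow> eval p xs (f xs)"
    using assms(1) unfolding computable_fun_def by blast
  have "\<forall>g\<in>set gs. \<exists>q. \<forall>xs. length xs = k \<longrightarrow> eval q xs (g xs)"
    using assms(2) unfolding computable_fun_def by blast
  then obtain Q where Q: "\<And>g xs. g \<in> set gs \<Longrightarrow> length xs = k \<Longrightarrow> eval (Q g) xs (g xs)"
    by metis
  have "eval (Comp p (map Q gs)) xs (f (map (\<lambda>g. g xs) gs))" if "length xs = k" for xs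
    by (rule eval.Comp[where ys = "map (\<lambda>g. g xs) gs"])
      (use that Q p in \<open>auto simp: list_all2_conv_all_nth\<close>)
  then show ?thesis unfolding computable_fun_def by blast
qed

lemma computable_fun_comp1:
  assumes "computable_fun 1 (\<lambda>xs. F (xs ! 0))" "computable_fun k f"
  shows "computable_fun k (\<lambda>xs. F (f xs))"
  using computable_fun_Comp[of "[f]" "\<lambda>xs. F (xs ! 0)" k] assms by simp

lemma computable_fun_comp2:
  assumes "computable_fun 2 (\<lambda>xs. F (xs ! 0) (xs ! 1))" "computable_fun k f" "computable_fun k g"
  shows "computable_fun k (\<lambda>xs. F (f xs) (g xs))"
proof -
  have "computable_fun (length [f, g]) (\<lambda>xs. F (xs ! 0) (xs ! 1))"
    using assms(1) by (simp add: numeral_2_eq_2)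
  from computable_fun_Comp[OF this, of k] show ?thesis using assms(2,3) by auto
qed

lemma computable_fun_Suc:
  assumes "computable_fun k f"
  shows "computable_fun k (\<lambda>xs. Suc (f xs))"
proof (rule computable_fun_comp1[OF _ assms])
  have "eval Succ xs (Suc (xs ! 0))" if "length xs = 1" for xs
    using that by (cases xs) (auto intro: eval.Succ)
  then show "computable_fun 1 (\<lambda>xs. Suc (xs ! 0))"
    unfolding computable_fun_def by blast
qed

lemma computable_fun_const: "computable_fun k (\<lambda>_. c)"
proof (induction c)
  case 0
  show ?case unfolding computable_fun_def by (metis eval.Zero)
next
  case (Suc c)
  then show ?case by (rule computable_fun_Suc)
qed

text \<open>\<open>b\<close> computes the number of iterations and \<open>f\<close> the initial
  value. The premise on \<open>g\<close> splits its tuple into counter, accumulated value and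
  parameters, the order in which \<open>PrimRec\<close> supplies them.\<close>

lemma computable_fun_rec_nat:
  assumes b: "computable_fun k b" and f: "computable_fun k f"
    and g: "computable_fun (Suc (Suc k)) (\<lambda>ys. g (ys ! 0) (tl ys ! 0) (tl (tl ys)))"
  shows "computable_fun k (\<lambda>xs. rec_nat (f xs) (\<lambda>n y. g n y xs) (b xs))"
proof -
  obtain p where p: "\<And>xs. length xs = k \<Longrightarrow> eval p xs (f xs)"
    using f unfolding computable_fun_def by blast
  obtain q where q: "\<And>ys. length ys = Suc (Suc k) \<Longrightarrow> eval q ys (g (ys ! 0) (tl ys ! 0) (tl (tl ys)))"
    using g unfolding computable_fun_def by blast
  have ev: "eval (PrimRec p q) (n # xs) (rec_nat (f xs) (\<lambda>n y. g n y xs) n)"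
    if xs: "length xs = k" for n xs
  proof (induction n)
    case 0
    show ?case using p[OF xs] by (auto intro: eval.PrimRec_0)
  next
    case (Suc n)
    show ?case
      using eval.PrimRec_Suc[OF Suc] q[of "n # _ # xs"] xs by simp
  qed
  let ?F = "\<lambda>ys. rec_nat (f (tl ys)) (\<lambda>n y. g n y (tl ys)) (ys ! 0)"
  \<comment> \<open>\<open>PrimRec\<close> recurses on the first entry of its tuple, so the count
    \<open>b xs\<close> is put in front of an unchanged copy of \<open>xs\<close>.\<close>
  let ?gs = "b # map (\<lambda>i xs. xs ! i) [0..<k]"
  have "eval (PrimRec p q) ys (?F ys)" if "length ys = Suc k" for ys
    using that ev[of "tl ys"] by (cases ys) auto
  then have "computable_fun (length ?gs) ?F"
    unfolding computable_fun_def by auto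
  then have "computable_fun k (\<lambda>xs. ?F (map (\<lambda>g. g xs) ?gs))"
    by (rule computable_fun_Comp) (use b in \<open>auto intro: computable_fun_nth\<close>)
  then show ?thesis
  proof (rule computable_fun_cong)
    fix xs :: "nat list" assume "length xs = k"
    then have "map ((!) xs) [0..<k] = xs" by (metis map_nth)
    then show "?F (map (\<lambda>g. g xs) ?gs) = rec_nat (f xs) (\<lambda>n y. g n y xs) (b xs)"
      by (simp add: comp_def)
  qed
qed

section \<open>Arithmetic functions\<close>

lemma computable_fun_add:
  assumes "computable_fun k f" "computable_fun k g"
  shows "computable_fun k (\<lambda>xs. f xs + g xs)"
proof -
  have eq: "a + b = rec_nat a (\<lambda>_ y. Suc y) b" for a b :: nat
    by (induction b) auto
  show ?thesis unfolding eq
    by (intro computable_fun_rec_nat computable_fun_Suc computable_fun_nth_tl assms) auto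
qed

lemma computable_fun_mult:
  assumes "computable_fun k f" "computable_fun k g"
  shows "computable_fun k (\<lambda>xs. f xs * g xs)"
proof (rule computable_fun_comp2[OF _ assms])
  have eq: "a * b = rec_nat 0 (\<lambda>_ y. y + a) b" for a b :: nat
    by (induction b) auto
  show "computable_fun 2 (\<lambda>xs. xs ! 0 * xs ! 1)" unfolding eq
    by (intro computable_fun_rec_nat computable_fun_add computable_fun_nth computable_fun_nth_tl
        computable_fun_nth_tl2 computable_fun_const) auto
qed

lemma computable_fun_power:
  assumes "computable_fun k f" "computable_fun k g"
  shows "computable_fun k (\<lambda>xs. f xs ^ g xs)"
proof (rule computable_fun_comp2[OF _ assms])
  have eq: "a ^ b = rec_nat 1 (\<lambda>_ y. y * a) b" for a b :: nat
    by (induction b) auto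
  show "computable_fun 2 (\<lambda>xs. xs ! 0 ^ xs ! 1)" unfolding eq
    by (intro computable_fun_rec_nat computable_fun_mult computable_fun_nth computable_fun_nth_tl
        computable_fun_nth_tl2 computable_fun_const) auto
qed

lemma computable_fun_diff:
  assumes "computable_fun k f" "computable_fun k g"
  shows "computable_fun k (\<lambda>xs. f xs - g xs)"
proof -
  \<comment> \<open>The predecessor is a recursion that returns its counter; truncated subtraction
    iterates it.\<close>
  have pred: "a - 1 = rec_nat 0 (\<lambda>n _. n) a" for a :: nat
    by (cases a) auto
  have diff: "a - b = rec_nat a (\<lambda>_ y. rec_nat 0 (\<lambda>n _. n) y) b" for a b :: nat
    by (induction b) (auto simp flip: pred)
  show ?thesis unfolding diff
    by (intro computable_fun_rec_nat computable_fun_const computable_fun_nth computable_fun_nth_tl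
        assms) auto
qed

section \<open>Decidable predicates and bounded quantifiers\<close>

lemma computable_pred_eq_0:
  assumes "computable_fun k f"
  shows "computable_pred k (\<lambda>xs. f xs = 0)"
proof -
  have "computable_fun k (\<lambda>xs. 1 - f xs)"
    by (intro computable_fun_diff computable_fun_const assms)
  then show ?thesis unfolding computable_pred_def
    by (rule computable_fun_cong) auto
qed

lemma computable_pred_eq:
  assumes "computable_fun k f" "computable_fun k g"
  shows "computable_pred k (\<lambda>xs. f xs = g xs)"
proof -
  have *: "(a::nat) = b \<longleftrightarrow> (a - b) + (b - a) = 0" for a b by auto
  show ?thesis
    by (subst *) (intro computable_pred_eq_0 computable_fun_diff computable_fun_add assms)
qed

lemma computable_pred_not:
  assumes "computable_pred k P"
  shows "computable_pred k (\<lambda>xs. \<not> P xs)"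
proof -
  have *: "\<not> b \<longleftrightarrow> (of_bool b :: nat) = 0" for b by auto
  show ?thesis unfolding *
    by (intro computable_pred_eq_0 assms[unfolded computable_pred_def])
qed

lemma computable_pred_conj:
  assumes "computable_pred k P" "computable_pred k Q"
  shows "computable_pred k (\<lambda>xs. P xs \<and> Q xs)"
  unfolding computable_pred_def of_bool_conj
  by (intro computable_fun_mult assms[unfolded computable_pred_def])

lemma computable_pred_disj:
  assumes "computable_pred k P" "computable_pred k Q"
  shows "computable_pred k (\<lambda>xs. P xs \<or> Q xs)"
proof -
  have *: "(P \<or> Q) \<longleftrightarrow> \<not> (\<not> P \<and> \<not> Q)" for P Q by auto
  show ?thesis by (subst *) (intro computable_pred_not computable_pred_conj assms)
qed

lemma computable_pred_imp:
  assumes "computable_pred k P" "computable_pred k Q"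
  shows "computable_pred k (\<lambda>xs. P xs \<longrightarrow> Q xs)"
proof -
  have *: "(P \<longrightarrow> Q) \<longleftrightarrow> \<not> (P \<and> \<not> Q)" for P Q by auto
  show ?thesis by (subst *) (intro computable_pred_not computable_pred_conj assms)
qed

lemma computable_pred_iff:
  assumes "computable_pred k P" "computable_pred k Q"
  shows "computable_pred k (\<lambda>xs. P xs \<longleftrightarrow> Q xs)"
  unfolding iff_conv_conj_imp by (intro computable_pred_conj computable_pred_imp assms)

lemma computable_pred_ex_less:
  assumes b: "computable_fun k b"
    and P: "computable_pred (Suc k) (\<lambda>ys. P (ys ! 0) (tl ys))"
  shows "computable_pred k (\<lambda>xs. \<exists>i<b xs. P i xs)"
proof -
  \<comment> \<open>On the values 0 and 1, disjunction of \<open>y\<close> and \<open>t\<close> is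
    \<open>1 - (1 - y) * (1 - t)\<close>, so a bounded search is a recursion accumulating this
    term.\<close>
  have *: "(of_bool (\<exists>i<n. P i xs) :: nat) =
      rec_nat 0 (\<lambda>i y. 1 - (1 - y) * (1 - of_bool (P i xs))) n" for n and xs :: "nat list"
  proof (induction n)
    case (Suc n)
    have ex: "(\<exists>i<Suc n. P i xs) \<longleftrightarrow> (\<exists>i<n. P i xs) \<or> P n xs"
      by (auto simp: less_Suc_eq)
    have disj: "of_bool (A \<or> B) = (1 :: nat) - (1 - of_bool A) * (1 - of_bool B)" for A B
      by auto
    show ?case by (simp only: ex disj Suc old.nat.rec)
  qed simp
  \<comment> \<open>The recursion step receives counter, accumulator and parameters.
    \<open>P\<close> does not see the accumulator, so the projections omit position 1.\<close>
  let ?gs = "(\<lambda>ys. ys ! 0) # map (\<lambda>i ys. ys ! Suc (Suc i)) [0..<k]"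
  have "computable_fun (length ?gs) (\<lambda>ys. of_bool (P (ys ! 0) (tl ys)))"
    using P unfolding computable_pred_def by simp
  then have "computable_fun (Suc (Suc k)) (\<lambda>ys. of_bool (P (map (\<lambda>g. g ys) ?gs ! 0) (tl (map (\<lambda>g. g ys) ?gs))))"
    by (rule computable_fun_Comp) (auto intro: computable_fun_nth)
  then have "computable_fun (Suc (Suc k)) (\<lambda>ys. of_bool (P (ys ! 0) (tl (tl ys))))"
  proof (rule computable_fun_cong)
    fix ys :: "nat list" assume "length ys = Suc (Suc k)"
    then have "tl (map (\<lambda>g. g ys) ?gs) = tl (tl ys)"
      by (auto intro!: nth_equalityI simp: nth_tl)
    then show "of_bool (P (map (\<lambda>g. g ys) ?gs ! 0) (tl (map (\<lambda>g. g ys) ?gs))) =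
        of_bool (P (ys ! 0) (tl (tl ys)))"
      by simp
  qed
  then show ?thesis
    unfolding computable_pred_def *
    by (intro computable_fun_rec_nat b computable_fun_const computable_fun_diff
        computable_fun_mult computable_fun_nth_tl) auto
qed

lemma computable_pred_all_less:
  assumes "computable_fun k b"
    and "computable_pred (Suc k) (\<lambda>ys. P (ys ! 0) (tl ys))"
  shows "computable_pred k (\<lambda>xs. \<forall>i<b xs. P i xs)"
proof -
  have *: "(\<forall>i<n. P i xs) \<longleftrightarrow> \<not> (\<exists>i<n. \<not> P i xs)" for n xs by auto
  show ?thesis unfolding *
    by (intro computable_pred_not computable_pred_ex_less assms)
qed

lemma computable_pred_set_decode:
  assumes "computable_fun k f" "computable_fun k g"
  shows "computable_pred k (\<lambda>xs. f xs \<in> set_decode (g xs))"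
proof -
  \<comment> \<open>Bit \<open>c\<close> of \<open>n\<close> is the parity of the quotient by
    \<open>2 ^ c\<close>. Writing out division with remainder leaves only arithmetic and bounded
    quantifiers.\<close>
  have eq: "c \<in> set_decode n \<longleftrightarrow> (\<exists>q<Suc n. \<exists>r<2 ^ c. n = (2 * q + 1) * 2 ^ c + r)" for c n :: nat
  proof
    assume "c \<in> set_decode n"
    then obtain q where q: "n div 2 ^ c = 2 * q + 1"
      unfolding set_decode_def by (auto elim: oddE)
    have "n = (2 * q + 1) * 2 ^ c + n mod 2 ^ c"
      using div_mult_mod_eq[of n "2 ^ c"] q by simp
    moreover have "q < Suc n"
      using q div_le_dividend[of n "2 ^ c"] by linarith
    ultimately show "\<exists>q<Suc n. \<exists>r<2 ^ c. n = (2 * q + 1) * 2 ^ c + r"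
      by (metis mod_less_divisor zero_less_numeral zero_less_power)
  next
    assume "\<exists>q<Suc n. \<exists>r<2 ^ c. n = (2 * q + 1) * 2 ^ c + r"
    then obtain q r where "r < 2 ^ c" "n = (2 * q + 1) * 2 ^ c + r" by blast
    then have "n div 2 ^ c = 2 * q + 1"
      by (simp only: div_mult_self3) simp
    then show "c \<in> set_decode n" unfolding set_decode_def by simp
  qed
  have "computable_pred 2 (\<lambda>xs. xs ! 0 \<in> set_decode (xs ! 1))"
    unfolding eq
    by (intro computable_pred_ex_less computable_pred_eq computable_fun_Suc computable_fun_add
        computable_fun_mult computable_fun_power computable_fun_const computable_fun_nth
        computable_fun_nth_tl computable_fun_nth_tl2) auto
  then show ?thesis
    unfolding computable_pred_def by (rule computable_fun_comp2[OF _ assms])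
qed

section \<open>Computable sets, relations and partial operations as functions on tuples\<close>

lemma computable_set_iff: "computable_set A \<longleftrightarrow> computable_pred 1 (\<lambda>xs. xs ! 0 \<in> A)"
proof -
  have "(\<forall>x. eval p [x] (if x \<in> A then 1 else 0)) \<longleftrightarrow>
      (\<forall>xs. length xs = 1 \<longrightarrow> eval p xs (of_bool (xs ! 0 \<in> A)))" for p
    by (auto simp: length_Suc_conv of_bool_def)
  then show ?thesis
    unfolding computable_set_def computable_pred_def computable_fun_def by presburger
qed

lemma computable_rel_iff: "computable_rel r \<longleftrightarrow> computable_pred 2 (\<lambda>xs. (xs ! 0, xs ! 1) \<in> r)"
proof -
  have "(\<forall>x y. eval p [x, y] (if (x, y) \<in> r then 1 else 0)) \<longleftrightarrow>
      (\<forall>xs. length xs = 2 \<longrightarrow> eval p xs (of_bool ((xs ! 0, xs ! 1) \<in> r)))" for p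
    by (auto simp: length_Suc_conv of_bool_def numeral_2_eq_2)
  then show ?thesis
    unfolding computable_rel_def computable_pred_def computable_fun_def by presburger
qed

lemma computable_pred_mem:
  assumes "computable_set A" "computable_fun k f"
  shows "computable_pred k (\<lambda>xs. f xs \<in> A)"
  using computable_fun_comp1[of "\<lambda>x. of_bool (x \<in> A)"] assms
  unfolding computable_set_iff computable_pred_def by blast

lemma computable_pred_rel:
  assumes "computable_rel r" "computable_fun k f" "computable_fun k g"
  shows "computable_pred k (\<lambda>xs. (f xs, g xs) \<in> r)"
  using computable_fun_comp2[of "\<lambda>x y. of_bool ((x, y) \<in> r)"] assms
  unfolding computable_rel_iff computable_pred_def by blast

text \<open>
  The given program for \<open>f\<close> need not halt outside \<open>A\<close>.  A primitive recursion on the characteristic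
  value of \<open>A\<close> runs it only on arguments from \<open>A\<close>.
\<close>

lemma computable_fun_totalize:
  assumes A: "computable_set A" and f: "computable_op_on A f"
  shows "computable_fun 2 (\<lambda>xs. if xs ! 0 \<in> A \<and> xs ! 1 \<in> A then f (xs ! 0) (xs ! 1) else 0)"
proof -
  let ?P = "\<lambda>xs. xs ! 0 \<in> A \<and> xs ! Suc 0 \<in> A"
  obtain p where p: "\<And>x y. x \<in> A \<Longrightarrow> y \<in> A \<Longrightarrow> eval p [x, y] (f x y)"
    using f unfolding computable_op_on_def by blast
  have "computable_pred 2 ?P"
    by (intro computable_pred_conj computable_pred_mem[OF A] computable_fun_nth) auto
  then obtain c where c: "\<And>xs. length xs = 2 \<Longrightarrow> eval c xs (of_bool (?P xs))"
    unfolding computable_pred_def computable_fun_def by blast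
  define q where "q = PrimRec Zero (Comp p [Proj 2, Proj 3])"
  have q: "eval q [of_bool (?P [x, y]), x, y] (if ?P [x, y] then f x y else 0)" for x y
  proof (cases "?P [x, y]")
    case True
    have "eval (Proj 2) [0, 0, x, y] x" "eval (Proj 3) [0, 0, x, y] y"
      using eval.Proj[of 2 "[0, 0, x, y]"] eval.Proj[of 3 "[0, 0, x, y]"] by auto
    then have "eval (Comp p [Proj 2, Proj 3]) [0, 0, x, y] (f x y)"
      using p True by (auto intro!: eval.Comp[where ys = "[x, y]"])
    then have "eval q [Suc 0, x, y] (f x y)"
      unfolding q_def by (intro eval.PrimRec_Suc[where y = 0] eval.PrimRec_0 eval.Zero)
    then show ?thesis using True by simp
  next
    case False
    then show ?thesis unfolding q_def by (auto intro: eval.PrimRec_0 eval.Zero)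
  qed
  have ev: "eval (Comp q [c, Proj 0, Proj 1]) [x, y] (if ?P [x, y] then f x y else 0)" for x y
    by (rule eval.Comp[where ys = "[of_bool (?P [x, y]), x, y]"])
      (use c[of "[x, y]"] q eval.Proj[of 0 "[x, y]"] eval.Proj[of 1 "[x, y]"] in auto)
  have "eval (Comp q [c, Proj 0, Proj 1]) xs (if ?P xs then f (xs ! 0) (xs ! 1) else 0)"
    if "length xs = 2" for xs
  proof -
    have "xs = [xs ! 0, xs ! 1]"
      using that by (auto intro!: nth_equalityI simp: less_Suc_eq numeral_2_eq_2)
    then obtain x y where "xs = [x, y]" by blast
    with ev[of x y] show ?thesis by (auto split: if_splits)
  qed
  then show ?thesis unfolding computable_fun_def One_nat_def by blast
qed

section \<open>Leading indices\<close>

definition lead :: "'b rel \<Rightarrow> ('b \<Rightarrow> int) \<Rightarrow> ('b \<Rightarrow> int) \<Rightarrow> 'b \<Rightarrow> bool" where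
  "lead r f g x \<longleftrightarrow> f x \<noteq> g x \<and> (\<forall>y. f y \<noteq> g y \<longrightarrow> (y, x) \<in> r)"

context
  fixes r :: "'b rel"
  assumes r: "Well_order r"
begin

lemma index_antisym: "(x, y) \<in> r \<Longrightarrow> (y, x) \<in> r \<Longrightarrow> x = y"
  using r unfolding order_on_defs by (blast dest: antisymD)

lemma index_trans: "(x, y) \<in> r \<Longrightarrow> (y, z) \<in> r \<Longrightarrow> (x, z) \<in> r"
  using r unfolding order_on_defs by (blast dest: transD)

lemma index_refl: "x \<in> Field r \<Longrightarrow> (x, x) \<in> r"
  using r unfolding order_on_defs by (blast dest: refl_onD)

lemma index_total: "x \<in> Field r \<Longrightarrow> y \<in> Field r \<Longrightarrow> (x, y) \<in> r \<or> (y, x) \<in> r"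
proof -
  assume xy: "x \<in> Field r" "y \<in> Field r"
  have "total_on (Field r) r"
    using r unfolding order_on_defs by blast
  then show ?thesis
    using xy index_refl by (cases "x = y") (auto simp: total_on_def)
qed

lemma index_induct: "(\<And>x. (\<And>y. (y, x) \<in> r \<Longrightarrow> y \<noteq> x \<Longrightarrow> P y) \<Longrightarrow> P x) \<Longrightarrow> P x"
  using wf_induct_rule[of "r - Id" P] r unfolding well_order_on_def by blast

lemma lead_unique: "lead r f g x \<Longrightarrow> lead r f g y \<Longrightarrow> x = y"
  unfolding lead_def using index_antisym by blast

lemma lead_Field: "lead r f g x \<Longrightarrow> x \<in> Field r"
  unfolding lead_def by (auto intro: FieldI1)

text \<open>Finite supports make the set of differences finite, and a nonempty finite subset of a
  linear order has a maximum.\<close>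

lemma lead_exists:
  assumes "f \<in> fin_supp_functions (Field r)" "g \<in> fin_supp_functions (Field r)" "f \<noteq> g"
  obtains x where "lead r f g x"
proof -
  let ?D = "{x. f x \<noteq> g x}"
  have "?D \<subseteq> {x. f x \<noteq> 0} \<union> {x. g x \<noteq> 0}" by auto
  then have fin: "finite ?D" and sub: "?D \<subseteq> Field r"
    using assms(1,2) unfolding fin_supp_functions_def by (auto intro: finite_subset)
  have max: "\<exists>x\<in>A. \<forall>y\<in>A. (y, x) \<in> r" if "finite A" "A \<noteq> {}" "A \<subseteq> Field r" for A
    using that
  proof (induction rule: finite_ne_induct)
    case (singleton x)
    then show ?case using index_refl by auto
  next
    case (insert a A)
    then obtain x where x: "x \<in> A" "\<forall>y\<in>A. (y, x) \<in> r" by auto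
    have aF: "a \<in> Field r" and "x \<in> Field r" using insert.prems x by auto
    then consider "(a, x) \<in> r" | "(x, a) \<in> r" using index_total by blast
    then show ?case
    proof cases
      case 1
      then show ?thesis using x by auto
    next
      case 2
      then have "\<forall>y\<in>insert a A. (y, a) \<in> r"
        using x index_trans index_refl[OF aF] by blast
      then show ?thesis by blast
    qed
  qed
  have "?D \<noteq> {}" using assms(3) by auto
  from max[OF fin this sub] obtain x where "x \<in> ?D" "\<forall>y\<in>?D. (y, x) \<in> r" by blast
  then have "lead r f g x" unfolding lead_def by simp
  then show ?thesis by (rule that)
qed

lemma int_power_less_iff:
  assumes "(f, g) \<in> int_power r" "lead r f g x"
  shows "f x < g x"
proof -
  obtain y where "f y \<noteq> g y" "\<forall>z. f z \<noteq> g z \<longrightarrow> (z, y) \<in> r" "f y < g y"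
    using assms unfolding int_power_def lead_def by auto
  then show ?thesis using lead_unique[OF assms(2), of y] unfolding lead_def by blast
qed

text \<open>From \<open>f\<close> to \<open>u\<close> and from \<open>u\<close> to \<open>g\<close>
  the change at the leading index is upward. Two increases cannot cancel, so the larger of the two
  leading indices is the leading index of \<open>f\<close> and \<open>g\<close>.\<close>

lemma lead_between:
  assumes fu: "(f, u) \<in> int_power r" and ug: "(u, g) \<in> int_power r" and fg: "lead r f g x"
  shows "f x \<le> u x" "u x \<le> g x" "f y \<noteq> u y \<Longrightarrow> (y, x) \<in> r"
proof -
  have "f x \<le> u x \<and> u x \<le> g x \<and> (\<forall>y. f y \<noteq> u y \<longrightarrow> (y, x) \<in> r)"
  proof (cases "f = u \<or> u = g")
    case True
    have "(f, g) \<in> int_power r" using True fu ug by auto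
    then have "f x < g x" using fg by (rule int_power_less_iff)
    then show ?thesis using True fg unfolding lead_def by auto
  next
    case False
    have "f \<in> fin_supp_functions (Field r)" "u \<in> fin_supp_functions (Field r)"
      "g \<in> fin_supp_functions (Field r)"
      using fu ug unfolding int_power_def by auto
    then obtain y z where y: "lead r f u y" and z: "lead r u g z"
      using False by (metis lead_exists)
    have fy: "f y < u y" and uz: "u z < g z"
      using int_power_less_iff fu ug y z by auto
    have yD: "(w, y) \<in> r" if "f w \<noteq> u w" for w
      using y that unfolding lead_def by blast
    have zD: "(w, z) \<in> r" if "u w \<noteq> g w" for w
      using z that unfolding lead_def by blast
    have fgD: "f w \<noteq> u w \<or> u w \<noteq> g w" if "f w \<noteq> g w" for w
      using that by auto
    consider "y = z" | "(y, z) \<in> r" "y \<noteq> z" | "(z, y) \<in> r" "y \<noteq> z"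
      using index_total lead_Field y z by blast
    then show ?thesis
    proof cases
      case 1
      have "f y \<noteq> g y" using 1 fy uz by auto
      then have "lead r f g y"
        using yD zD fgD 1 unfolding lead_def by blast
      then have "x = y" using fg lead_unique by blast
      then show ?thesis using 1 yD fy uz by auto
    next
      case 2
      then have fz: "f z = u z" using yD index_antisym by blast
      have w: "(w, z) \<in> r" if "f w \<noteq> u w" for w
        using yD[OF that] 2(1) by (rule index_trans)
      have "f z \<noteq> g z" using fz uz by simp
      then have "lead r f g z"
        using w zD fgD unfolding lead_def by blast
      then have "x = z" using fg lead_unique by blast
      then show ?thesis using w fz uz by auto
    next
      case 3
      then have gy: "u y = g y" using zD index_antisym by blast
      have w: "(w, y) \<in> r" if "u w \<noteq> g w" for w
        using zD[OF that] 3(1) by (rule index_trans)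
      have "f y \<noteq> g y" using gy fy by simp
      then have "lead r f g y"
        using w yD fgD unfolding lead_def by blast
      then have "x = y" using fg lead_unique by blast
      then show ?thesis using yD gy fy by auto
    qed
  qed
  then show "f x \<le> u x" "u x \<le> g x" "f y \<noteq> u y \<Longrightarrow> (y, x) \<in> r" by auto
qed

lemma fin_supp_functions_upd:
  assumes "f \<in> fin_supp_functions (Field r)" "x \<in> Field r"
  shows "f(x := c) \<in> fin_supp_functions (Field r)"
proof -
  have "{y. (f(x := c)) y \<noteq> 0} \<subseteq> insert x {y. f y \<noteq> 0}" by auto
  then show ?thesis
    using assms finite_subset[of "{y. (f(x := c)) y \<noteq> 0}" "insert x {y. f y \<noteq> 0}"]
    unfolding fin_supp_functions_def by blast
qed

lemma int_power_upd:
  assumes "f \<in> fin_supp_functions (Field r)" "x \<in> Field r" "c \<le> d"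
  shows "(f(x := c), f(x := d)) \<in> int_power r"
proof (cases "c = d")
  case False
  then have "(f(x := c)) x \<noteq> (f(x := d)) x \<and> (\<forall>y. (f(x := c)) y \<noteq> (f(x := d)) y \<longrightarrow> (y, x) \<in> r) \<and>
      (f(x := c)) x < (f(x := d)) x"
    using assms(2,3) index_refl by auto
  then show ?thesis
    using fin_supp_functions_upd[OF assms(1,2)] unfolding int_power_def by blast
qed (use fin_supp_functions_upd[OF assms(1,2)] in \<open>simp add: int_power_def\<close>)

text \<open>
  If the image of \<open>[f, g]\<close> had a smaller leading index \<open>x\<close>, the images of infinitely many points
  \<open>f + n \<delta>\<^sub>x\<close> of \<open>[f, g]\<close> would lie in an interval admitting finitely many values at \<open>x\<close>, so two
  consecutive ones would differ only below \<open>x\<close>; this gives a counterexample with a smaller \<open>x\<close>.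
\<close>

lemma lead_strict_mono_le:
  assumes mono: "\<And>u v. (u, v) \<in> int_power r \<Longrightarrow> (\<phi> u, \<phi> v) \<in> int_power r"
    and inj: "inj_on \<phi> (fin_supp_functions (Field r))"
    and "(f, g) \<in> int_power r" "lead r f g y" "lead r (\<phi> f) (\<phi> g) x"
  shows "(y, x) \<in> r"
  using assms(3-5)
proof (induction x arbitrary: f g y rule: index_induct)
  case (1 x)
  show ?case
  proof (rule ccontr)
    assume neg: "(y, x) \<notin> r"
    have xF: "x \<in> Field r" and yF: "y \<in> Field r" using 1 lead_Field by auto
    then have xy: "(x, y) \<in> r" "x \<noteq> y" using neg index_total index_refl by blast+
    \<comment> \<open>These points lie between \<open>f\<close> and \<open>g\<close>: the comparison
      with \<open>g\<close> is decided at \<open>y\<close>, above the modified index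
      \<open>x\<close>.\<close>
    define u where "u n = f(x := f x + int n)" for n
    have fF: "f \<in> fin_supp_functions (Field r)" and gF: "g \<in> fin_supp_functions (Field r)"
      using "1.prems"(1) unfolding int_power_def by auto
    have uF: "u n \<in> fin_supp_functions (Field r)" for n
      unfolding u_def using fF xF by (rule fin_supp_functions_upd)
    have u_less: "(u n, u (Suc n)) \<in> int_power r" for n
      unfolding u_def using fF xF by (rule int_power_upd) simp
    have fu: "(f, u n) \<in> int_power r" for n
      using int_power_upd[OF fF xF, of "f x" "f x + int n"] by (simp add: u_def)
    have ug: "(u n, g) \<in> int_power r" for n
    proof -
      have "u n y = f y" "f y < g y"
        using xy 1 int_power_less_iff unfolding u_def by auto
      moreover have "\<forall>z. u n z \<noteq> g z \<longrightarrow> (z, y) \<in> r"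
        using "1.prems"(2) xy unfolding u_def lead_def by auto
      ultimately show ?thesis
        using uF gF unfolding int_power_def by (auto intro!: exI[of _ y])
    qed
    have lead_u: "lead r (u n) (u (Suc n)) x" for n
      using index_refl[OF xF] unfolding lead_def u_def by auto
    note bounds = lead_between[OF mono[OF fu] mono[OF ug] "1.prems"(3)]
    have step: "\<phi> (u n) x < \<phi> (u (Suc n)) x" for n
    proof (rule ccontr)
      assume "\<not> \<phi> (u n) x < \<phi> (u (Suc n)) x"
      moreover have pF: "\<phi> (u n) \<in> fin_supp_functions (Field r)" for n
        using mono[OF u_less] unfolding int_power_def by auto
      have "u n \<noteq> u (Suc n)" using lead_u[of n] unfolding lead_def by auto
      then have "\<phi> (u n) \<noteq> \<phi> (u (Suc n))"
        using inj uF unfolding inj_on_def by blast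
      then obtain x' where x': "lead r (\<phi> (u n)) (\<phi> (u (Suc n))) x'"
        using pF lead_exists by blast
      then have less: "\<phi> (u n) x' < \<phi> (u (Suc n)) x'"
        using mono[OF u_less] int_power_less_iff by blast
      ultimately have "x' \<noteq> x" by auto
      \<comment> \<open>Values that differ at \<open>x'\<close> cannot both agree with
        \<open>\<phi> f\<close> there, and points of the image interval differ from
        \<open>\<phi> f\<close> at most up to \<open>x\<close>.\<close>
      moreover have "\<phi> f x' \<noteq> \<phi> (u n) x' \<or> \<phi> f x' \<noteq> \<phi> (u (Suc n)) x'"
        using less by auto
      then have "(x', x) \<in> r" using bounds(3) by blast
      \<comment> \<open>The pair \<open>u n\<close>, \<open>u (Suc n)\<close> has leading index
        \<open>x\<close>, its image the smaller \<open>x'\<close>; the induction hypothesis for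
        \<open>x'\<close> yields \<open>(x, x') \<in> r\<close>.\<close>
      ultimately show False
        using "1.IH"[OF _ _ u_less lead_u x'] index_antisym by blast
    qed
    have lower: "\<phi> f x + int n \<le> \<phi> (u n) x" for n
    proof (induction n)
      case 0
      show ?case using bounds(1)[of 0] by simp
    next
      case (Suc n)
      then show ?case using step[of n] by simp
    qed
    have "int n \<le> \<phi> g x - \<phi> f x" for n
      using lower[of n] bounds(2)[of n] by linarith
    from this[of "Suc (nat (\<phi> g x - \<phi> f x))"] show False by linarith
  qed
qed

end

section \<open>Archimedean classes of an ordered group of order type \<open>\<int>\<^sup>X\<close>\<close>

locale int_power_group = ordered_group G R for G :: "'a monoid" (structure) and R +
  fixes r :: "'b rel" and h :: "'a \<Rightarrow> 'b \<Rightarrow> int"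
  assumes index_wo: "Well_order r"
    and h_bij: "bij_betw h (carrier G) (fin_supp_functions (Field r))"
    and h_order: "\<lbrakk>a \<in> carrier G; b \<in> carrier G\<rbrakk> \<Longrightarrow> (a, b) \<in> R \<longleftrightarrow> (h a, h b) \<in> int_power r"
begin

definition positive :: "'a \<Rightarrow> bool" where
  "positive a \<longleftrightarrow> (\<one>, a) \<in> R \<and> a \<noteq> \<one>"

text \<open>\<open>h\<close> need not send \<open>\<one>\<close> to the zero function, so
  differences are taken against \<open>h \<one>\<close>.\<close>

definition val :: "'a \<Rightarrow> 'b \<Rightarrow> bool" where
  "val a x \<longleftrightarrow> lead r (h \<one>) (h a) x"

lemma R_carrier:
  assumes "(a, b) \<in> R"
  shows "a \<in> carrier G" "b \<in> carrier G"
  using assms linear_order unfolding order_on_defs by auto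

lemma R_refl: "a \<in> carrier G \<Longrightarrow> (a, a) \<in> R"
  using linear_order unfolding order_on_defs by (auto dest: refl_onD)

lemma R_antisym: "(a, b) \<in> R \<Longrightarrow> (b, a) \<in> R \<Longrightarrow> a = b"
  using linear_order unfolding order_on_defs by (auto dest: antisymD)

lemma R_trans: "(a, b) \<in> R \<Longrightarrow> (b, c) \<in> R \<Longrightarrow> (a, c) \<in> R"
  using linear_order unfolding order_on_defs by (auto dest: transD)

lemma R_total:
  assumes "a \<in> carrier G" "b \<in> carrier G"
  shows "(a, b) \<in> R \<or> (b, a) \<in> R"
proof -
  have "total_on (carrier G) R" using linear_order unfolding order_on_defs by blast
  then show ?thesis using assms R_refl unfolding total_on_def by metis
qed

lemma positive_carrier: "positive a \<Longrightarrow> a \<in> carrier G"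
  unfolding positive_def using R_carrier by blast

lemma h_less: "(a, b) \<in> R \<Longrightarrow> lead r (h a) (h b) x \<Longrightarrow> h a x < h b x"
  using int_power_less_iff[OF index_wo] h_order R_carrier by blast

lemma h_mono: "(a, b) \<in> R \<Longrightarrow> (h a, h b) \<in> int_power r"
  using h_order R_carrier by blast

lemma h_inj: "a \<in> carrier G \<Longrightarrow> b \<in> carrier G \<Longrightarrow> h a = h b \<Longrightarrow> a = b"
  using h_bij unfolding bij_betw_def inj_on_def by blast

lemma h_fin_supp: "a \<in> carrier G \<Longrightarrow> h a \<in> fin_supp_functions (Field r)"
  using h_bij unfolding bij_betw_def by blast

lemma lead_h_exists:
  assumes "a \<in> carrier G" "b \<in> carrier G" "a \<noteq> b"
  obtains x where "lead r (h a) (h b) x"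
proof (rule lead_exists[OF index_wo h_fin_supp h_fin_supp])
  show "h a \<noteq> h b" using assms h_inj by blast
qed (use assms that in auto)

text \<open>Transported through \<open>h\<close>, left multiplication by \<open>c\<close> is an
  injective monotone self-map of the finitely supported functions.\<close>

lemma lead_translate_le:
  assumes c: "c \<in> carrier G" and ab: "(a, b) \<in> R"
    and y: "lead r (h a) (h b) y" and x: "lead r (h (c \<otimes> a)) (h (c \<otimes> b)) x"
  shows "(y, x) \<in> r"
proof (rule lead_strict_mono_le[OF index_wo])
  let ?g = "inv_into (carrier G) h"
  let ?\<phi> = "\<lambda>u. h (c \<otimes> ?g u)"
  have g: "?g u \<in> carrier G" "h (?g u) = u" if "u \<in> fin_supp_functions (Field r)" for u
    using that h_bij unfolding bij_betw_def by (auto intro: inv_into_into f_inv_into_f)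
  have gh: "?g (h a) = a" if "a \<in> carrier G" for a
    using that h_bij unfolding bij_betw_def by simp
  show "(?\<phi> u, ?\<phi> v) \<in> int_power r" if uv: "(u, v) \<in> int_power r" for u v
  proof -
    have F: "u \<in> fin_supp_functions (Field r)" "v \<in> fin_supp_functions (Field r)"
      using uv unfolding int_power_def by auto
    then have "(?g u, ?g v) \<in> R" using uv h_order g by simp
    then show ?thesis using c by (intro h_mono mult_left_mono)
  qed
  show "inj_on ?\<phi> (fin_supp_functions (Field r))"
  proof (rule inj_onI)
    fix u v assume F: "u \<in> fin_supp_functions (Field r)" "v \<in> fin_supp_functions (Field r)"
      and "?\<phi> u = ?\<phi> v"
    then have "c \<otimes> ?g u = c \<otimes> ?g v"
      by (intro h_inj) (auto simp: c g)
    then have "?g u = ?g v" using c g F by simp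
    then show "u = v" using g(2) F by metis
  qed
  show "(h a, h b) \<in> int_power r" using ab by (rule h_mono)
  show "lead r (h a) (h b) y" by fact
  show "lead r (?\<phi> (h a)) (?\<phi> (h b)) x"
    using x gh R_carrier[OF ab] by simp
qed

text \<open>Multiplication by \<open>c\<close> cannot lower the leading index, and neither can
  multiplication by \<open>inv c\<close>, which undoes it.\<close>

lemma lead_translate:
  assumes c: "c \<in> carrier G" and ab: "(a, b) \<in> R" and y: "lead r (h a) (h b) y"
  shows "lead r (h (c \<otimes> a)) (h (c \<otimes> b)) y"
proof -
  note [simp] = R_carrier[OF ab]
  have "a \<noteq> b" using y unfolding lead_def by auto
  then have "c \<otimes> a \<noteq> c \<otimes> b" using c by simp
  then obtain x where x: "lead r (h (c \<otimes> a)) (h (c \<otimes> b)) x"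
    using lead_h_exists[of "c \<otimes> a" "c \<otimes> b"] c by auto
  have "(y, x) \<in> r" using c ab y x by (rule lead_translate_le)
  moreover have "(x, y) \<in> r"
  proof (rule lead_translate_le)
    show "inv c \<in> carrier G" using c by simp
    show "(c \<otimes> a, c \<otimes> b) \<in> R" using ab c by (rule mult_left_mono)
    show "lead r (h (inv c \<otimes> (c \<otimes> a))) (h (inv c \<otimes> (c \<otimes> b))) y"
      using c y by (simp add: m_assoc[symmetric])
  qed (rule x)
  ultimately have "x = y" using index_antisym[OF index_wo] by blast
  then show ?thesis using x by simp
qed

section \<open>Powers of positive elements and their classes\<close>

lemma pow_Suc_less:
  assumes "positive a"
  shows "(a [^] n, a [^] Suc n) \<in> R" "a [^] n \<noteq> a [^] Suc n"
proof -
  note [simp] = positive_carrier[OF assms]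
  show "(a [^] n, a [^] Suc n) \<in> R"
    using mult_left_mono[of \<one> a "a [^] n"] assms unfolding positive_def by simp
  show "a [^] n \<noteq> a [^] Suc n"
  proof
    assume "a [^] n = a [^] Suc n"
    then have "a [^] n \<otimes> \<one> = a [^] n \<otimes> a" by simp
    then have "\<one> = a" using Units_l_cancel[of "a [^] n" \<one> a] by simp
    then show False using assms unfolding positive_def by simp
  qed
qed

lemma pow_le:
  fixes m n :: nat
  assumes "positive a" "m \<le> n"
  shows "(a [^] m, a [^] n) \<in> R"
  using assms(2)
proof (induction n rule: dec_induct)
  case base
  show ?case using assms(1) by (intro R_refl nat_pow_closed positive_carrier)
next
  case (step n)
  then show ?case using R_trans pow_Suc_less(1)[OF assms(1)] by blast
qed

lemma pow_less:
  fixes m n :: nat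
  assumes "positive a" "m < n"
  shows "a [^] m \<noteq> a [^] n"
proof
  assume "a [^] m = a [^] n"
  then have "(a [^] Suc m, a [^] m) \<in> R"
    using pow_le[OF assms(1), of "Suc m" n] assms(2) by simp
  then show False using pow_Suc_less[OF assms(1)] R_antisym by blast
qed

lemma positive_pow: "positive a \<Longrightarrow> positive (a [^] Suc n)"
  using pow_le[of a 0 "Suc n"] pow_less[of a 0 "Suc n"] unfolding positive_def by auto

lemma val_exists:
  assumes "positive a"
  obtains x where "val a x"
  using lead_h_exists[of \<one> a] assms positive_carrier[OF assms]
  unfolding val_def positive_def by auto

text \<open>The pair \<open>\<one>\<close>, \<open>a\<close> is translated by
  \<open>a [^] n\<close>. Hence every further factor raises the coordinate at \<open>x\<close> by at
  least one.\<close>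

lemma val_step:
  assumes "positive a" "val a x"
  shows "lead r (h (a [^] n)) (h (a [^] Suc n)) x"
  using lead_translate[of "a [^] n" \<one> a x] assms positive_carrier[OF assms(1)]
  unfolding val_def positive_def by simp

lemma val_step_less:
  assumes "positive a" "val a x"
  shows "h (a [^] n) x < h (a [^] Suc n) x"
  using h_less[OF pow_Suc_less(1) val_step] assms by blast

lemma val_pow:
  assumes "positive a" "val a x"
  shows "val (a [^] Suc n) x"
proof (induction n)
  case 0
  show ?case using assms positive_carrier by simp
next
  case (Suc n)
  have "h \<one> x < h (a [^] Suc n) x"
    using h_less Suc positive_pow[OF assms(1)] unfolding val_def positive_def by blast
  also have "\<dots> < h (a [^] Suc (Suc n)) x"
    by (rule val_step_less[OF assms])
  finally have "h \<one> x \<noteq> h (a [^] Suc (Suc n)) x" by simp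
  moreover have "(y, x) \<in> r" if "h \<one> y \<noteq> h (a [^] Suc (Suc n)) y" for y
  proof (cases "h \<one> y = h (a [^] Suc n) y")
    case True
    then show ?thesis using that val_step[OF assms, of "Suc n"] unfolding lead_def by simp
  next
    case False
    then show ?thesis using Suc unfolding val_def lead_def by blast
  qed
  ultimately show ?case unfolding val_def lead_def by blast
qed

text \<open>\<open>a\<close> lies between \<open>\<one>\<close> and \<open>b\<close>, so it cannot
  differ from \<open>\<one>\<close> above the leading index of \<open>b\<close>.\<close>

lemma val_mono:
  assumes "positive a" "(a, b) \<in> R" "val a x" "val b y"
  shows "(x, y) \<in> r"
  using lead_between(3)[OF index_wo h_mono h_mono, of \<one> a b y x] assms
  unfolding val_def positive_def lead_def by blast

lemma pow_less_of_val_less: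
  assumes "positive a" "positive b" "val a x" "val b y" "(x, y) \<in> r" "x \<noteq> y"
  shows "(b, a [^] (n :: nat)) \<notin> R"
proof
  assume "(b, a [^] n) \<in> R"
  \<comment> \<open>\<open>val_pow\<close> concerns positive exponents only, so the exponent is
    raised by one.\<close>
  then have "(b, a [^] Suc n) \<in> R"
    using R_trans pow_Suc_less(1)[OF assms(1)] by blast
  then have "(y, x) \<in> r"
    using val_mono assms(2,4) val_pow[OF assms(1,3)] by blast
  then show False using assms(5,6) index_antisym[OF index_wo] by blast
qed

text \<open>Monotonicity gives \<open>(x, y) \<in> r\<close>. If \<open>x = y\<close>, then
  \<open>b\<close> would bound the coordinate at \<open>x\<close> of all powers of \<open>a\<close>,
  but this coordinate grows with every factor.\<close>

lemma val_less_of_pow_less: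
  assumes a: "positive a" and b: "positive b" and x: "val a x" and y: "val b y"
    and less: "\<And>n :: nat. (b, a [^] n) \<notin> R"
  shows "(x, y) \<in> r \<and> x \<noteq> y"
proof -
  have le: "(a [^] n, b) \<in> R" for n :: nat
    using less[of n] R_total[of "a [^] n" b] positive_carrier a b by auto
  from le[of 1] have "(a, b) \<in> R" using positive_carrier[OF a] by simp
  then have "(x, y) \<in> r" using val_mono a x y by blast
  moreover have "x \<noteq> y"
  proof
    assume "x = y"
    have lower: "h \<one> x + int n \<le> h (a [^] n) x" for n
    proof (induction n)
      case (Suc n)
      then show ?case using val_step_less[OF a x, of n] by simp
    qed simp
    have one: "(\<one>, a [^] n) \<in> R" for n :: nat
      using pow_le[OF a, of 0 n] by simp
    have upper: "h (a [^] n) x \<le> h b x" for n :: nat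
      using lead_between(2)[OF index_wo h_mono[OF one] h_mono[OF le], of x n] y \<open>x = y\<close>
      unfolding val_def by simp
    have "int n \<le> h b x - h \<one> x" for n
      using lower[of n] upper[of n] by linarith
    from this[of "Suc (nat (h b x - h \<one> x))"] show False by linarith
  qed
  ultimately show ?thesis by blast
qed

lemma val_surj:
  assumes x: "x \<in> Field r"
  obtains a where "positive a" "val a x"
proof -
  let ?f = "(h \<one>)(x := h \<one> x + 1)"
  have F: "h \<one> \<in> fin_supp_functions (Field r)" by (simp add: h_fin_supp)
  then have "?f \<in> fin_supp_functions (Field r)"
    using fin_supp_functions_upd[OF index_wo] x by blast
  then obtain a where a: "a \<in> carrier G" "h a = ?f"
    using h_bij unfolding bij_betw_def by (metis imageE)
  have "(h \<one>, ?f) \<in> int_power r"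
    using int_power_upd[OF index_wo F x, of "h \<one> x" "h \<one> x + 1"] by simp
  then have "(\<one>, a) \<in> R" using a h_order by simp
  moreover have "h a x \<noteq> h \<one> x" using a by simp
  then have "a \<noteq> \<one>" by auto
  moreover have "val a x"
    unfolding val_def lead_def using a index_refl[OF index_wo x] by auto
  ultimately show ?thesis using that unfolding positive_def by blast
qed

text \<open>The powers of one representative are pairwise distinct and stay in its class. If the
  elements are natural numbers, every class thus has members beyond any bound.\<close>

lemma infinite_val:
  assumes "x \<in> Field r"
  shows "infinite {a. positive a \<and> val a x}"
proof -
  obtain a where a: "positive a" "val a x" using val_surj[OF assms] .
  have "inj (\<lambda>n. a [^] Suc n)"
    by (rule linorder_injI) (rule pow_less[OF a(1)], simp)
  then have "infinite (range (\<lambda>n. a [^] Suc n))"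
    by (rule range_inj_infinite)
  moreover have "range (\<lambda>n. a [^] Suc n) \<subseteq> {a. positive a \<and> val a x}"
    using positive_pow val_pow a by blast
  ultimately show ?thesis using finite_subset by blast
qed

end

section \<open>Finite sets of naturals in lexicographic order\<close>

text \<open>
  If a finite set is read as the increasing sequence of its elements, this is the Kleene--Brouwer
  order: proper end extensions come first, otherwise the first difference decides.
\<close>

definition code_less :: "nat \<Rightarrow> nat \<Rightarrow> bool" where
  "code_less n m \<longleftrightarrow>
     (\<exists>c. c \<in> set_decode n \<and> c \<notin> set_decode m \<and> (\<forall>d<c. d \<in> set_decode n \<longleftrightarrow> d \<in> set_decode m))"

text \<open>Makes quantifiers over a coded set bounded, and forces the code of a set with a large
  element to be large.\<close>

lemma less_of_mem_set_decode:
  assumes "c \<in> set_decode n"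
  shows "c < n"
proof (rule ccontr)
  assume "\<not> c < n"
  then have "n < 2 ^ c" using less_exp[of c] by linarith
  then show False using assms unfolding set_decode_def by simp
qed

lemma code_less_irrefl: "\<not> code_less n n"
  unfolding code_less_def by blast

lemma code_less_trans:
  assumes "code_less n m" "code_less m k"
  shows "code_less n k"
proof -
  obtain c where c: "c \<in> set_decode n" "c \<notin> set_decode m" "\<forall>d<c. d \<in> set_decode n \<longleftrightarrow> d \<in> set_decode m"
    using assms(1) unfolding code_less_def by blast
  obtain c' where c': "c' \<in> set_decode m" "c' \<notin> set_decode k" "\<forall>d<c'. d \<in> set_decode m \<longleftrightarrow> d \<in> set_decode k"
    using assms(2) unfolding code_less_def by blast
  have "c \<noteq> c'" using c c' by auto
  then consider "c < c'" | "c' < c" by linarith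
  then show ?thesis
  proof cases
    case 1
    then show ?thesis unfolding code_less_def using c c' by (intro exI[of _ c]) auto
  next
    case 2
    then show ?thesis unfolding code_less_def using c c' by (intro exI[of _ c']) auto
  qed
qed

lemma code_less_total:
  assumes "n \<noteq> m"
  shows "code_less n m \<or> code_less m n"
proof -
  let ?P = "\<lambda>c. (c \<in> set_decode n) \<noteq> (c \<in> set_decode m)"
  have "set_decode n \<noteq> set_decode m" using assms set_decode_inverse by metis
  then have "\<exists>c. ?P c" by auto
  then obtain c where "?P c" "\<forall>d<c. \<not> ?P d"
    using LeastI_ex[of ?P] not_less_Least[of _ ?P] by blast
  then show ?thesis unfolding code_less_def by (cases "c \<in> set_decode n") auto
qed

text \<open>
  The characteristic functions along a descending chain increase lexicographically, so they converge
  pointwise.  A finite limit would be reached and could not be passed.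
\<close>

lemma infinite_limit_of_descending_codes:
  assumes desc: "\<And>k. code_less (s (Suc k)) (s k)"
  shows "infinite {i. \<exists>K. \<forall>k\<ge>K. i \<in> set_decode (s k)}"
proof
  define L where "L = {i. \<exists>K. \<forall>k\<ge>K. i \<in> set_decode (s k)}"
  have stable: "\<exists>K. \<forall>k\<ge>K. \<forall>d<i. d \<in> set_decode (s k) \<longleftrightarrow> d \<in> set_decode (s K)" for i
  proof (induction i)
    case (Suc i)
    then obtain K where K: "\<And>k d. k \<ge> K \<Longrightarrow> d < i \<Longrightarrow> d \<in> set_decode (s k) \<longleftrightarrow> d \<in> set_decode (s K)"
      by blast
    \<comment> \<open>With the bits below \<open>i\<close> fixed, a step first differs at
      \<open>i\<close> or above, and does so by adding an element; hence bit \<open>i\<close> is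
      never lost.\<close>
    have step: "i \<in> set_decode (s (Suc k))" if "k \<ge> K" "i \<in> set_decode (s k)" for k
    proof -
      obtain c where c: "c \<in> set_decode (s (Suc k))" "c \<notin> set_decode (s k)"
        "\<forall>d<c. d \<in> set_decode (s (Suc k)) \<longleftrightarrow> d \<in> set_decode (s k)"
        using desc[of k] unfolding code_less_def by blast
      have "\<not> c < i" using c K[of k c] K[of "Suc k" c] that by auto
      moreover have "c \<noteq> i" using c that by auto
      ultimately show ?thesis using c that by auto
    qed
    show ?case
    proof (cases "\<exists>k\<ge>K. i \<in> set_decode (s k)")
      case True
      then obtain k where k: "k \<ge> K" "i \<in> set_decode (s k)" by blast
      have in_k: "i \<in> set_decode (s l)" if "l \<ge> k" for l
        using that k step by (induction l rule: dec_induct) auto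
      have "d \<in> set_decode (s l) \<longleftrightarrow> d \<in> set_decode (s k)" if "l \<ge> k" "d < Suc i" for l d
        using in_k[OF that(1)] in_k[of k] K[of l d] K[of k d] k that by (cases "d = i") auto
      then show ?thesis by blast
    next
      case False
      have "d \<in> set_decode (s l) \<longleftrightarrow> d \<in> set_decode (s K)" if "l \<ge> K" "d < Suc i" for l d
        using False K[of l d] that by (cases "d = i") auto
      then show ?thesis by blast
    qed
  qed simp
  have limit: "i \<in> L"
    if K: "\<And>k d. k \<ge> K \<Longrightarrow> d < j \<Longrightarrow> d \<in> set_decode (s k) \<longleftrightarrow> d \<in> set_decode (s K)"
      and i: "i < j" "i \<in> set_decode (s K)" for i j K
  proof -
    have "i \<in> set_decode (s k)" if "k \<ge> K" for k
      using K[OF that i(1)] i(2) by simp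
    then show ?thesis unfolding L_def by blast
  qed
  assume "finite {i. \<exists>K. \<forall>k\<ge>K. i \<in> set_decode (s k)}"
  then have "finite L" unfolding L_def .
  then obtain M where M: "\<And>i. i \<in> L \<Longrightarrow> i < M"
    unfolding finite_nat_set_iff_bounded by blast
  obtain K where K: "\<And>k d. k \<ge> K \<Longrightarrow> d < M \<Longrightarrow> d \<in> set_decode (s k) \<longleftrightarrow> d \<in> set_decode (s K)"
    using stable[of M] by blast
  have first: "\<exists>c\<ge>M. c \<in> set_decode (s (Suc k)) \<and> (\<forall>d<c. d \<in> set_decode (s (Suc k)) \<longleftrightarrow> d \<in> set_decode (s k))"
    if "k \<ge> K" for k
  proof -
    obtain c where c: "c \<in> set_decode (s (Suc k))" "c \<notin> set_decode (s k)"
      "\<forall>d<c. d \<in> set_decode (s (Suc k)) \<longleftrightarrow> d \<in> set_decode (s k)"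
      using desc[of k] unfolding code_less_def by blast
    then have "\<not> c < M" using K[of k c] K[of "Suc k" c] that by auto
    then show ?thesis using c by (intro exI[of _ c]) auto
  qed
  obtain c where c: "c \<ge> M" "c \<in> set_decode (s (Suc K))" using first[of K] by blast
  \<comment> \<open>A step either adds some \<open>c' \<le> c\<close> or changes nothing up to
    \<open>c\<close>, so the elements between \<open>M\<close> and \<open>c\<close> never die
    out.\<close>
  have persist: "\<exists>e\<ge>M. e \<le> c \<and> e \<in> set_decode (s k)" if "k \<ge> Suc K" for k
    using that
  proof (induction k rule: dec_induct)
    case base
    show ?case using c by blast
  next
    case (step k)
    then obtain e where e: "e \<ge> M" "e \<le> c" "e \<in> set_decode (s k)" by blast
    obtain c' where c': "c' \<ge> M" "c' \<in> set_decode (s (Suc k))"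
      "\<forall>d<c'. d \<in> set_decode (s (Suc k)) \<longleftrightarrow> d \<in> set_decode (s k)"
      using first[of k] step by auto
    show ?case
    proof (cases "c' \<le> c")
      case True
      then show ?thesis using c' by blast
    next
      case False
      then show ?thesis using e c' by auto
    qed
  qed
  \<comment> \<open>Once all bits up to \<open>c\<close> have settled, such an element is permanent
    and belongs to \<open>L\<close>, contrary to the bound \<open>M\<close>.\<close>
  obtain K' where K': "\<And>k d. k \<ge> K' \<Longrightarrow> d < Suc c \<Longrightarrow> d \<in> set_decode (s k) \<longleftrightarrow> d \<in> set_decode (s K')"
    using stable[of "Suc c"] by blast
  let ?N = "max K' (Suc K)"
  obtain e where e: "e \<ge> M" "e \<le> c" "e \<in> set_decode (s ?N)"
    using persist[of ?N] by auto
  have "d \<in> set_decode (s k) \<longleftrightarrow> d \<in> set_decode (s ?N)" if "k \<ge> ?N" "d < Suc c" for k d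
    using K'[of k d] K'[of ?N d] that by simp
  then have "e \<in> L" by (rule limit) (use e in auto)
  then have "e < M" by (rule M)
  then show False using e by simp
qed


section \<open>A computable well-order of type at least \<open>\<alpha>\<close>\<close>

locale nat_int_power_group = int_power_group G R r h
  for G :: "nat monoid" (structure) and R and r :: "'b rel" and h
begin

text \<open>
  A node codes a finite set whose elements, taken in the order of the natural numbers, look
  infinitely descending in the sense of Archimedean classes as far as powers up to the code itself
  can tell.  The true condition on all powers is not decidable, but it holds for the limit of an
  infinite branch because the codes along the branch are unbounded.
\<close>

definition nodes :: "nat set" where
  "nodes = {n. (\<forall>a\<in>set_decode n. positive a) \<and>
     (\<forall>b\<in>set_decode n. \<forall>a\<in>set_decode n. a < b \<longrightarrow> (a, b [^] n) \<notin> R)}"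

definition node_order :: "nat rel" where
  "node_order = {(n, m). n \<in> nodes \<and> m \<in> nodes \<and> (n = m \<or> code_less n m)}"

lemma Field_node_order: "Field node_order = nodes"
  unfolding node_order_def Field_def by auto

lemma wf_node_order: "wf (node_order - Id)"
proof (unfold wf_iff_no_infinite_down_chain, rule notI, elim exE)
  fix s assume s: "\<forall>k. (s (Suc k), s k) \<in> node_order - Id"
  define L where "L = {i. \<exists>K. \<forall>k\<ge>K. i \<in> set_decode (s k)}"
  have nodes: "s k \<in> nodes" and "code_less (s (Suc k)) (s k)" for k
    using spec[OF s, of k] unfolding node_order_def by auto
  from this(2) have inf: "infinite L"
    unfolding L_def by (rule infinite_limit_of_descending_codes)
  have eventually: "\<exists>k\<ge>K. i \<in> set_decode (s k)" if i: "i \<in> L" for i K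
  proof -
    obtain K' where "\<forall>k\<ge>K'. i \<in> set_decode (s k)" using i unfolding L_def by blast
    then show ?thesis by (intro exI[of _ "max K K'"]) simp
  qed
  have pos: "positive a" if "a \<in> L" for a
    using eventually[OF that, of 0] nodes unfolding nodes_def by blast
  have desc: "(a, b [^] n) \<notin> R" if a: "a \<in> L" and b: "b \<in> L" and "a < b" for a b and n :: nat
  proof
    assume R: "(a, b [^] n) \<in> R"
    \<comment> \<open>A code containing \<open>c\<close> exceeds \<open>n\<close>, so its node
      condition tests a power of \<open>b\<close> at least as high as the
      \<open>n\<close>-th.\<close>
    obtain c where c: "c \<in> L" "c > n" using inf unfolding infinite_nat_iff_unbounded by blast
    obtain K where K: "\<forall>k\<ge>K. a \<in> set_decode (s k)" using a unfolding L_def by blast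
    obtain K' where K': "\<forall>k\<ge>K'. b \<in> set_decode (s k)" using b unfolding L_def by blast
    obtain k where k: "k \<ge> max K K'" "c \<in> set_decode (s k)" using eventually[OF c(1)] by blast
    have "n \<le> s k" using less_of_mem_set_decode[OF k(2)] c(2) by simp
    then have "(a, b [^] s k) \<in> R" using R pow_le[OF pos[OF b]] R_trans by blast
    moreover have "a \<in> set_decode (s k)" "b \<in> set_decode (s k)" using K K' k by auto
    ultimately show False using nodes[of k] \<open>a < b\<close> unfolding nodes_def by blast
  qed
  \<comment> \<open>The increasing enumeration of \<open>L\<close> runs through strictly decreasing
    classes, an infinite descent in \<open>r\<close>.\<close>
  let ?e = "enumerate L"
  have e: "?e i \<in> L" for i using inf by (rule enumerate_in_set)
  have "\<exists>x. val (?e i) x" for i using val_exists[OF pos[OF e]] by blast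
  then obtain v where v: "\<And>i. val (?e i) (v i)" by metis
  have "(v (Suc i), v i) \<in> r - Id" for i
    using val_less_of_pow_less[OF pos[OF e] pos[OF e] v v, of i "Suc i"]
      desc[OF e e enumerate_step[OF inf, of i]] by blast
  then show False
    using index_wo unfolding well_order_on_def wf_iff_no_infinite_down_chain by blast
qed

lemma Well_order_node_order: "Well_order node_order"
proof -
  have "refl_on nodes node_order"
    unfolding refl_on_def node_order_def by auto
  moreover have "node_order \<subseteq> nodes \<times> nodes"
    unfolding node_order_def by auto
  moreover have "trans node_order"
    unfolding trans_def node_order_def using code_less_trans by blast
  moreover have "antisym node_order"
    unfolding antisym_def node_order_def using code_less_trans code_less_irrefl by blast
  moreover have "total_on nodes node_order"
    unfolding total_on_def node_order_def using code_less_total by blast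
  ultimately show ?thesis
    using wf_node_order unfolding Field_node_order order_on_defs by blast
qed

text \<open>The node condition with all powers instead of the single one tested by the code: in
  increasing order of the elements, their classes really descend. The lower bound on the order type
  uses only these nodes.\<close>

definition genuine :: "nat \<Rightarrow> bool" where
  "genuine n \<longleftrightarrow> (\<forall>a\<in>set_decode n. positive a) \<and>
     (\<forall>b\<in>set_decode n. \<forall>a\<in>set_decode n. a < b \<longrightarrow> (\<forall>k::nat. (a, b [^] k) \<notin> R))"

lemma genuine_node: "genuine n \<Longrightarrow> n \<in> nodes"
  unfolding genuine_def nodes_def by blast

text \<open>All powers of \<open>c\<close> stay below \<open>b\<close>. One reaching
  \<open>a\<close> would therefore give \<open>a \<le> b\<close> in \<open>R\<close>, which for a
  number \<open>a < b\<close> contradicts the condition on \<open>n\<close> with exponent 1.\<close>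

lemma genuine_extend:
  assumes n: "genuine n" and b: "b \<in> set_decode n" and max: "\<forall>a\<in>set_decode n. a \<le> b"
    and c: "positive c" "b < c" and x: "val b x" and y: "val c y" and yx: "(y, x) \<in> r" "y \<noteq> x"
  shows "genuine (set_encode (insert c (set_decode n)))"
proof -
  have pos: "positive a" if "a \<in> set_decode n" for a
    using n that unfolding genuine_def by blast
  have "(a, c [^] k) \<notin> R" if a: "a \<in> set_decode n" for a and k :: nat
  proof
    assume R: "(a, c [^] k) \<in> R"
    have bc: "(b, c [^] k) \<notin> R"
      by (rule pow_less_of_val_less[OF c(1) pos[OF b] y x yx])
    then have "(c [^] k, b) \<in> R"
      using R_total[of b "c [^] k"] positive_carrier[OF c(1)] positive_carrier[OF pos[OF b]] by auto
    then have "(a, b [^] (1::nat)) \<in> R"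
      using R R_trans positive_carrier[OF pos[OF b]] by auto
    moreover have "a < b" using max a R bc by (metis order_le_imp_less_or_eq)
    ultimately show False using n a b unfolding genuine_def by blast
  qed
  moreover have "a < c" if "a \<in> set_decode n" for a using that max c(2) by fastforce
  ultimately show ?thesis
    using n c(1) unfolding genuine_def by (auto dest: order_less_asym)
qed

text \<open>
  Otherwise the nodes embed into a proper initial segment of \<open>r\<close>.  By induction, the image of a
  genuine node is at least the class of its last element, because every smaller class is that of the
  last element of some one-point extension, which precedes the node.
\<close>

lemma index_le_node_order: "r \<le>o node_order"
proof (rule ccontr)
  assume "\<not> r \<le>o node_order"
  then have "node_order <o r"
    using index_wo Well_order_node_order not_ordLeq_iff_ordLess by blast
  then obtain z where z: "z \<in> Field r" and "node_order =o Restr r (underS r z)"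
    using ordLess_iff_ordIso_Restr[OF index_wo Well_order_node_order] by blast
  then obtain f where f: "BNF_Wellorder_Embedding.iso node_order (Restr r (underS r z)) f"
    unfolding ordIso_def by blast
  have f_mono: "(f n, f m) \<in> r" if "(n, m) \<in> node_order" for n m
    using iso_forward[OF that f] by simp
  have f_under: "f n \<in> underS r z" if "n \<in> nodes" for n
    using iso_forward[of n n, OF _ f] that unfolding node_order_def by simp
  have f_inj: "n = m" if "n \<in> nodes" "m \<in> nodes" "f n = f m" for n m
    using f that unfolding BNF_Wellorder_Embedding.iso_def bij_betw_def inj_on_def Field_node_order by blast
  have dom: "(x, f n) \<in> r"
    if "genuine n" "b \<in> set_decode n" "\<forall>a\<in>set_decode n. a \<le> b" "val b x" for x n b
    using that
  proof (induction x arbitrary: n b rule: index_induct[OF index_wo])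
    case (1 x)
    note n = "1.prems"
    show ?case
    proof (rule ccontr)
      assume neg: "(x, f n) \<notin> r"
      have y: "f n \<in> Field r"
        using f_under[OF genuine_node[OF n(1)]] unfolding underS_def by (auto intro: FieldI1)
      have "x \<in> Field r" using n(4) lead_Field[OF index_wo] unfolding val_def by blast
      then have yx: "(f n, x) \<in> r" "f n \<noteq> x"
        using neg y index_total[OF index_wo] index_refl[OF index_wo] by blast+
      \<comment> \<open>The class \<open>f n\<close> is below \<open>x\<close> and has
        representatives larger than \<open>b\<close>, so one of them can be appended as new last
        element.\<close>
      obtain c where c: "b < c" "positive c" "val c (f n)"
        using infinite_val[OF y] unfolding infinite_nat_iff_unbounded by blast
      let ?n = "set_encode (insert c (set_decode n))"
      have dec: "set_decode ?n = insert c (set_decode n)" by simp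
      have gen: "genuine ?n"
        by (rule genuine_extend[OF n(1,2,3) c(2,1) n(4) c(3) yx])
      have less: "\<forall>a\<in>set_decode n. a < c" using n(3) c(1) by fastforce
      \<comment> \<open>The induction hypothesis at the smaller class \<open>f n\<close> applies to
        the extension; yet the extension strictly precedes \<open>n\<close>, and \<open>f\<close>
        preserves this.\<close>
      have "(f n, f ?n) \<in> r"
        using "1.IH"[OF yx gen _ _ c(3)] less unfolding dec by (simp add: less_imp_le)
      moreover have "code_less ?n n"
        unfolding code_less_def dec using less by (intro exI[of _ c]) auto
      then have "(?n, n) \<in> node_order" "?n \<noteq> n"
        using genuine_node gen n(1) code_less_irrefl unfolding node_order_def by auto
      then have "(f ?n, f n) \<in> r" "f ?n \<noteq> f n"
        using f_mono f_inj genuine_node gen n(1) by blast+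
      ultimately show False using index_antisym[OF index_wo] by blast
    qed
  qed
  \<comment> \<open>A singleton from the class \<open>z\<close> must be sent to \<open>z\<close> or
    above, outside the supposed range of \<open>f\<close>.\<close>
  obtain a where a: "positive a" "val a z" using val_surj[OF z] .
  have dec: "set_decode (set_encode {a}) = {a}" by (rule set_encode_inverse) simp
  have gen: "genuine (set_encode {a})"
    unfolding genuine_def dec using a by simp
  have "(z, f (set_encode {a})) \<in> r"
    using dom[OF gen _ _ a(2)] unfolding dec by simp
  then show False
    using f_under[OF genuine_node[OF gen]] index_antisym[OF index_wo] unfolding underS_def by blast
qed

section \<open>Computability of the nodes and of their order\<close>

context
  assumes carrier: "computable_set (carrier G)"
    and mult: "computable_op_on (carrier G) (mult G)"
    and R: "computable_rel R"
begin

lemma computable_nodes: "computable_set nodes"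
proof -
  \<comment> \<open>The default value 0 makes the product total. For \<open>b\<close> in the
    carrier, the recursion \<open>P\<close> starts at \<open>\<one>\<close> and never leaves the
    carrier, so it computes the true powers.\<close>
  define M where "M x y = (if x \<in> carrier G \<and> y \<in> carrier G then x \<otimes> y else 0)" for x y
  define P where "P b n = rec_nat \<one> (\<lambda>_ y. M y b) n" for b n
  have M: "computable_fun 2 (\<lambda>xs. M (xs ! 0) (xs ! 1))"
    unfolding M_def by (rule computable_fun_totalize[OF carrier mult])
  have "computable_fun 2 (\<lambda>xs. P (xs ! 0) (xs ! 1))"
    unfolding P_def
    by (intro computable_fun_rec_nat computable_fun_comp2[OF M] computable_fun_const
        computable_fun_nth computable_fun_nth_tl computable_fun_nth_tl2) auto
  note P = computable_fun_comp2[OF this]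
  have pow: "P b n = b [^] n" if "b \<in> carrier G" for b n
    by (induction n) (use that in \<open>simp_all add: P_def M_def\<close>)
  have nodes: "n \<in> nodes \<longleftrightarrow>
      (\<forall>a<n. a \<in> set_decode n \<longrightarrow> (\<one>, a) \<in> R \<and> \<not> a = \<one>) \<and>
      (\<forall>b<n. \<forall>a<b. b \<in> set_decode n \<longrightarrow> a \<in> set_decode n \<longrightarrow> \<not> (a, P b n) \<in> R)" for n
  proof -
    have "n \<in> nodes \<longleftrightarrow> (\<forall>a\<in>set_decode n. positive a) \<and>
        (\<forall>b\<in>set_decode n. \<forall>a\<in>set_decode n. a < b \<longrightarrow> (a, P b n) \<notin> R)"
      unfolding nodes_def using pow positive_carrier by auto
    then show ?thesis
      unfolding positive_def using less_of_mem_set_decode by blast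
  qed
  show ?thesis
    unfolding computable_set_iff nodes
    by (intro computable_pred_conj computable_pred_all_less computable_pred_imp computable_pred_not
        computable_pred_set_decode computable_pred_rel[OF R] computable_pred_eq P
        computable_fun_const computable_fun_nth computable_fun_nth_tl computable_fun_nth_tl2) auto
qed

lemma computable_node_order: "computable_rel node_order"
proof -
  have eq: "(n, m) \<in> node_order \<longleftrightarrow> n \<in> nodes \<and> m \<in> nodes \<and>
      (n = m \<or> (\<exists>c<n. c \<in> set_decode n \<and> \<not> c \<in> set_decode m \<and>
        (\<forall>d<c. d \<in> set_decode n \<longleftrightarrow> d \<in> set_decode m)))" for n m
    unfolding node_order_def code_less_def using less_of_mem_set_decode by blast
  show ?thesis
    unfolding computable_rel_iff eq
    by (intro computable_pred_conj computable_pred_disj computable_pred_ex_less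
        computable_pred_all_less computable_pred_iff computable_pred_not computable_pred_eq
        computable_pred_set_decode computable_pred_mem[OF computable_nodes]
        computable_fun_nth computable_fun_nth_tl computable_fun_nth_tl2) auto
qed

lemma computable_ordinal_node_order: "computable_ordinal node_order"
  unfolding computable_ordinal_def
  using Well_order_node_order computable_nodes computable_node_order Field_node_order
    ordIso_reflexive by metis

end

end

text \<open>A proper initial segment is cut out by one element, which enters the decision procedures
  as a constant; so the segment and its restricted order are again computable.\<close>

lemma computable_ordinal_ordLeq:
  assumes "r \<le>o s" "computable_ordinal s"
  shows "computable_ordinal r"
proof -
  obtain t :: "nat rel" where t: "Well_order t" "computable_set (Field t)" "computable_rel t" "s =o t"
    using assms(2) unfolding computable_ordinal_def by blast
  have r: "Well_order r" using assms(1) unfolding ordLeq_def by blast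
  have "r \<le>o t" using assms(1) t(4) ordLeq_ordIso_trans by blast
  then consider "r =o t" | "r <o t" using ordLeq_iff_ordLess_or_ordIso by blast
  then show ?thesis
  proof cases
    case 1
    then show ?thesis using t unfolding computable_ordinal_def by blast
  next
    case 2
    then obtain a where a: "a \<in> Field t" "r =o Restr t (underS t a)"
      using ordLess_iff_ordIso_Restr[OF t(1) r] by blast
    let ?S = "underS t a"
    have field: "Field (Restr t ?S) = ?S"
      using t(1) by (intro Refl_Field_Restr2) (auto simp: order_on_defs underS_def Field_def)
    have S: "computable_pred k (\<lambda>xs. f xs \<in> ?S)" if "computable_fun k f" for k f
      using that unfolding underS_def mem_Collect_eq
      by (intro computable_pred_conj computable_pred_not computable_pred_eq
          computable_pred_rel[OF t(3)] computable_fun_const)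
    have "computable_set ?S"
      unfolding computable_set_iff by (intro S computable_fun_nth) simp
    moreover have "computable_rel (Restr t ?S)"
      unfolding computable_rel_iff Int_iff mem_Sigma_iff
      by (intro computable_pred_conj computable_pred_rel[OF t(3)] S computable_fun_nth) auto
    moreover have "Well_order (Restr t ?S)" using t(1) by (rule Well_order_Restr)
    ultimately show ?thesis
      using a(2) field unfolding computable_ordinal_def by metis
  qed
qed

theorem proposition2p7:
  fixes G :: "nat monoid" and R :: "nat rel" and \<alpha> :: "'a rel"
  assumes "computable_ordered_group G R"
    and "Well_order \<alpha>"
    and "has_order_type R (int_power \<alpha>)"
  shows "\<alpha> <o omega1_CK"
proof -
  interpret ordered_group G R
    using assms(1) unfolding computable_ordered_group_def by blast
  have FR: "Field R = carrier G"
    using linear_order unfolding order_on_defs Field_def by (auto dest: refl_onD)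
  have FZ: "Field (int_power \<alpha>) = fin_supp_functions (Field \<alpha>)"
    unfolding int_power_def Field_def by auto
  obtain h where h: "bij_betw h (carrier G) (fin_supp_functions (Field \<alpha>))"
    "\<forall>x\<in>carrier G. \<forall>y\<in>carrier G. (x, y) \<in> R \<longleftrightarrow> (h x, h y) \<in> int_power \<alpha>"
    using assms(3) unfolding has_order_type_def FR FZ by blast
  interpret nat_int_power_group G R \<alpha> h
    by unfold_locales (use assms(2) h in auto)
  have "computable_ordinal node_order"
    using assms(1) unfolding computable_ordered_group_def
    by (intro computable_ordinal_node_order) auto
  then have "computable_ordinal \<alpha>"
    using index_le_node_order computable_ordinal_ordLeq by blast
  show ?thesis
  proof (rule ccontr)
    assume "\<not> \<alpha> <o omega1_CK"
    then have "omega1_CK \<le>o \<alpha>"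
      using assms(2) omega1_CK_props not_ordLess_iff_ordLeq by blast
    then have "computable_ordinal omega1_CK"
      using \<open>computable_ordinal \<alpha>\<close> computable_ordinal_ordLeq by blast
    then show False using omega1_CK_props by blast
  qed
qed

end
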